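(* Let $X$ be a finite dataset, and fix $k\in\mathbb{Z}$, $\epsilon\in\mathbb{R}$ and a positive integer $MinPts$. Let $\{\mathbb{B}_i\}_{i\in I}$ be a filtration of covers of $X$ by bins, and let DBSCAN with parameters $\epsilon$ and $MinPts$ be used to cluster each bin of each $\mathbb{B}_i$, giving cluster covers $\mathbb{C}_{\mathbb{B}_i}$. If no free-border points exist with respect to $\epsilon$ and $MinPts$ (in any of the bins), then: (1) there is a filtration of simplicial complexes $\{\phi^{\mathbb{B}_i,\mathbb{B}_j}:\mathbb{N}(\mathbb{C}_{\mathbb{B}_i})\to\mathbb{N}(\mathbb{C}_{\mathbb{B}_j}),\ \forall\,\mathbb{B}_i\le\mathbb{B}_j\}$, induced by a filtration of the cluster covers $\mathbb{C}_{\mathbb{B}_i}$, where $\mathbb{N}(\mathbb{C}_{\mathbb{B}_i})$ is the nerve whose vertices are the clusters; (2) there is an induced filtration of homology groups $\{f^{\mathbb{B}_i,\mathbb{B}_j}:H_k(\mathbb{N}(\mathbb{C}_{\mathbb{B}_i}))\to H_k(\mathbb{N}(\mathbb{C}_{\mathbb{B}_j})),\ \forall\,\mathbb{B}_i\le\mathbb{B}_j\}$.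
   Context: DBSCAN. Let $Y$ be a finite (ordered) set of points in a metric space, $\epsilon\in\mathbb{R}$, $MinPts$ a positive integer, and $N_\epsilon(p)=\{q\in Y: dist(p,q)\le\epsilon\}$ for $p\in Y$. A point $p\in Y$ is a core point if $|N_\epsilon(p)|\ge MinPts$; a border point if it is not core but lies in $N_\epsilon(p')$ for some core point $p'$; and noise otherwise. A point $q$ is directly density-reachable from $p$ if $p$ is core and $q\in N_\epsilon(p)$. A point $q$ is density-reachable from $p$ if there are points $p=\alpha_1,\dots,\alpha_n=q$ in $Y$, $n\ge 2$, with each $\alpha_{i+1}$ directly density-reachable from $\alpha_i$. Points $p,q$ are density-connected if there is a point $o\in Y$ from which both are density-reachable. DBSCAN outputs a partition $Y=C_1\sqcup\dots\sqcup C_n\sqcup N$, with $N$ the set of noise points and the clusters $C_i$, each containing at least one core point, satisfying: (Maximality) if $p\in C_i$, $q\notin \bigsqcup_{j<i}C_j$ and $q$ is density-reachable from $p$, then $q\in C_i$; (Connectivity) any $p,q\in C_i$ are density-connected. The assignment of some border points may depend on the ordering of $Y$. A point $s\in Y$ is a free-border point with respect to $\epsilon$ and $MinPts$ if $|N_\epsilon(s)|<MinPts$ and there are core points $p,q\in Y$ with $s\in N_\epsilon(p)$, $s\in N_\epsilon(q)$ and $p$ not density-connected to $q$. Bins and cluster covers. A bin is a subset of $X$; $\mathbb{B}_i$ is a finite indexed collection of bins covering $X$. DBSCAN is run separately inside each bin (with $Y$ = the bin). The cluster cover $\mathbb{C}_{\mathbb{B}_i}$ is the family of all clusters so obtained,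 indexed by the bin they come from (clusters in different bins are different elements even if equal as sets); noise points belong to no cluster, and the word "cover" is used regardless. Filtrations. A family $\{\mathbb{U}_\lambda\}$ of covers indexed by a partially ordered parameter set is a filtration if it has maps $u^{\lambda,\mu}:\mathbb{U}_\lambda\to\mathbb{U}_\mu$ for $\lambda\le\mu$ such that $u^{\lambda,\mu}(U)=V$ implies $U\subseteq V$, and $u^{\mu,\nu}\circ u^{\lambda,\mu}=u^{\lambda,\nu}$ for $\lambda\le\mu\le\nu$. The same definition is used for cluster covers. For bin covers we write $\mathbb{B}_i\le\mathbb{B}_j$ (for $i\le j$), so every bin in $\mathbb{B}_i$ is contained in a bin of $\mathbb{B}_j$. The nerve $\mathbb{N}(\mathbb{U})$ of an indexed family $\mathbb{U}=\{U_\alpha\}_{\alpha\in A}$ is the simplicial complex with vertex set $A$ in which $\{\alpha_0,\dots,\alpha_n\}$ is a simplex iff $U_{\alpha_0}\cap\dots\cap U_{\alpha_n}\ne\emptyset$. A filtration of simplicial complexes (resp. homology groups) is a family of simplicial maps (resp. homomorphisms) $\phi^{\lambda,\mu}$ for $\lambda\le\mu$ with $\phi^{\mu,\nu}\circ\phi^{\lambda,\mu}=\phi^{\lambda,\nu}$. It is induced by a filtration of cluster covers if the simplicial maps act on vertices by the maps of the cluster-cover filtration, and the homomorphisms are the maps induced on $H_k$ by these simplicial maps. Homology is simplicial, with a fixed coefficient group. *)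

theory Defs
  imports "HOL-Analysis.Analysis" "HOL-Algebra.Coset" "HOL-Combinatorics.Permutations"
begin

section \<open>DBSCAN\<close>

definition eps_nbhd :: "'a::metric_space set \<Rightarrow> real \<Rightarrow> 'a \<Rightarrow> 'a set" where
  "eps_nbhd Y \<epsilon> p = {q \<in> Y. dist p q \<le> \<epsilon>}"

definition core_point :: "'a::metric_space set \<Rightarrow> real \<Rightarrow> nat \<Rightarrow> 'a \<Rightarrow> bool" where
  "core_point Y \<epsilon> MinPts p \<longleftrightarrow> p \<in> Y \<and> card (eps_nbhd Y \<epsilon> p) \<ge> MinPts"

definition border_point :: "'a::metric_space set \<Rightarrow> real \<Rightarrow> nat \<Rightarrow> 'a \<Rightarrow> bool" where
  "border_point Y \<epsilon> MinPts p \<longleftrightarrow>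
     p \<in> Y \<and> \<not> core_point Y \<epsilon> MinPts p \<and>
     (\<exists>p'. core_point Y \<epsilon> MinPts p' \<and> p \<in> eps_nbhd Y \<epsilon> p')"

definition noise :: "'a::metric_space set \<Rightarrow> real \<Rightarrow> nat \<Rightarrow> 'a set" where
  "noise Y \<epsilon> MinPts =
     {p \<in> Y. \<not> core_point Y \<epsilon> MinPts p \<and> \<not> border_point Y \<epsilon> MinPts p}"

text \<open>The relations below are read from left to right: \<open>directly_density_reachable Y \<epsilon> MinPts p q\<close>
  says that \<open>q\<close> is directly density-reachable from \<open>p\<close>.\<close>

definition directly_density_reachable ::
    "'a::metric_space set \<Rightarrow> real \<Rightarrow> nat \<Rightarrow> 'a \<Rightarrow> 'a \<Rightarrow> bool" where
  "directly_density_reachable Y \<epsilon> MinPts p q \<longleftrightarrow> core_point Y \<epsilon> MinPts p \<and> q \<in> eps_nbhd Y \<epsilon> p"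

text \<open>The transitive (not reflexive) closure: chains have at least two entries, and each entry
  automatically lies in \<open>Y\<close>.\<close>

definition density_reachable ::
    "'a::metric_space set \<Rightarrow> real \<Rightarrow> nat \<Rightarrow> 'a \<Rightarrow> 'a \<Rightarrow> bool" where
  "density_reachable Y \<epsilon> MinPts = (directly_density_reachable Y \<epsilon> MinPts)\<^sup>+\<^sup>+"

definition density_connected ::
    "'a::metric_space set \<Rightarrow> real \<Rightarrow> nat \<Rightarrow> 'a \<Rightarrow> 'a \<Rightarrow> bool" where
  "density_connected Y \<epsilon> MinPts p q \<longleftrightarrow>
     (\<exists>o'\<in>Y. density_reachable Y \<epsilon> MinPts o' p \<and> density_reachable Y \<epsilon> MinPts o' q)"

definition free_border_point :: "'a::metric_space set \<Rightarrow> real \<Rightarrow> nat \<Rightarrow> 'a \<Rightarrow> bool" where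
  "free_border_point Y \<epsilon> MinPts s \<longleftrightarrow>
     s \<in> Y \<and> card (eps_nbhd Y \<epsilon> s) < MinPts \<and>
     (\<exists>p q. core_point Y \<epsilon> MinPts p \<and> core_point Y \<epsilon> MinPts q \<and>
            s \<in> eps_nbhd Y \<epsilon> p \<and> s \<in> eps_nbhd Y \<epsilon> q \<and>
            \<not> density_connected Y \<epsilon> MinPts p q)"

text \<open>\<open>Cs\<close> is a possible list of clusters, in order of discovery, returned by DBSCAN on \<open>Y\<close>.
  Different orderings of \<open>Y\<close> may give different lists, so this is a relation.\<close>

definition dbscan_clusters :: "real \<Rightarrow> nat \<Rightarrow> 'a::metric_space set \<Rightarrow> 'a set list \<Rightarrow> bool" where
  "dbscan_clusters \<epsilon> MinPts Y Cs \<longleftrightarrow>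
     (\<forall>i<length Cs. \<forall>j<length Cs. i \<noteq> j \<longrightarrow> Cs ! i \<inter> Cs ! j = {}) \<and>
     (\<Union>i<length Cs. Cs ! i) \<inter> noise Y \<epsilon> MinPts = {} \<and>
     (\<Union>i<length Cs. Cs ! i) \<union> noise Y \<epsilon> MinPts = Y \<and>
     (\<forall>i<length Cs. \<exists>p\<in>Cs ! i. core_point Y \<epsilon> MinPts p) \<and>
     (\<forall>i<length Cs. \<forall>p q. p \<in> Cs ! i \<and> q \<notin> (\<Union>j<i. Cs ! j) \<and> density_reachable Y \<epsilon> MinPts p q
         \<longrightarrow> q \<in> Cs ! i) \<and>
     (\<forall>i<length Cs. \<forall>p\<in>Cs ! i. \<forall>q\<in>Cs ! i. density_connected Y \<epsilon> MinPts p q)"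

section \<open>Indexed covers and their filtrations\<close>

text \<open>An indexed family of sets is given by an index set \<open>A\<close> and a map \<open>U\<close> on indices.\<close>

definition bin_cover :: "'a set \<Rightarrow> 'b set \<Rightarrow> ('b \<Rightarrow> 'a set) \<Rightarrow> bool" where
  "bin_cover X A B \<longleftrightarrow> finite A \<and> (\<forall>a\<in>A. B a \<subseteq> X) \<and> (\<Union>a\<in>A. B a) = X"

definition cover_filtration ::
    "'i::order set \<Rightarrow> ('i \<Rightarrow> 'v set) \<Rightarrow> ('i \<Rightarrow> 'v \<Rightarrow> 'a set) \<Rightarrow> ('i \<Rightarrow> 'i \<Rightarrow> 'v \<Rightarrow> 'v) \<Rightarrow> bool" where
  "cover_filtration I A U u \<longleftrightarrow>
     (\<forall>i\<in>I. \<forall>j\<in>I. i \<le> j \<longrightarrow> (\<forall>a\<in>A i. u i j a \<in> A j \<and> U i a \<subseteq> U j (u i j a))) \<and>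
     (\<forall>i\<in>I. \<forall>j\<in>I. \<forall>l\<in>I. i \<le> j \<and> j \<le> l \<longrightarrow> (\<forall>a\<in>A i. u j l (u i j a) = u i l a))"

text \<open>Given bins indexed by \<open>A\<close> and the list of clusters \<open>C a\<close> of every bin \<open>a\<close>, the cluster cover is
  indexed by the pairs of a bin and a position in its list of clusters.\<close>

definition cluster_index :: "'b set \<Rightarrow> ('b \<Rightarrow> 'a set list) \<Rightarrow> ('b \<times> nat) set" where
  "cluster_index A C = (SIGMA a:A. {..<length (C a)})"

definition cluster_of :: "('b \<Rightarrow> 'a set list) \<Rightarrow> 'b \<times> nat \<Rightarrow> 'a set" where
  "cluster_of C v = C (fst v) ! snd v"

section \<open>Simplicial complexes and nerves\<close>

text \<open>A complex is its set of (nonempty) simplices; its vertex set is the union of these.\<close>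

definition simplicial_complex :: "'v set set \<Rightarrow> bool" where
  "simplicial_complex K \<longleftrightarrow>
     (\<forall>\<sigma>\<in>K. finite \<sigma> \<and> \<sigma> \<noteq> {} \<and> (\<forall>\<tau>. \<tau> \<subseteq> \<sigma> \<and> \<tau> \<noteq> {} \<longrightarrow> \<tau> \<in> K))"

definition simplicial_map :: "'v set set \<Rightarrow> 'w set set \<Rightarrow> ('v \<Rightarrow> 'w) \<Rightarrow> bool" where
  "simplicial_map K L f \<longleftrightarrow> (\<forall>\<sigma>\<in>K. f ` \<sigma> \<in> L)"

definition nerve :: "'v set \<Rightarrow> ('v \<Rightarrow> 'a set) \<Rightarrow> 'v set set" where
  "nerve A U = {\<sigma>. \<sigma> \<subseteq> A \<and> finite \<sigma> \<and> \<sigma> \<noteq> {} \<and> (\<Inter>a\<in>\<sigma>. U a) \<noteq> {}}"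

lemma vertices_nerve:
  assumes "\<forall>a\<in>A. U a \<noteq> {}"
  shows "\<Union> (nerve A U) = A"
proof
  show "A \<subseteq> \<Union> (nerve A U)"
  proof
    fix a assume "a \<in> A"
    then have "{a} \<in> nerve A U" using assms by (auto simp: nerve_def)
    then show "a \<in> \<Union> (nerve A U)" by blast
  qed
qed (auto simp: nerve_def)

definition cluster_nerve :: "'b set \<Rightarrow> ('b \<Rightarrow> 'a set list) \<Rightarrow> ('b \<times> nat) set set" where
  "cluster_nerve A C = nerve (cluster_index A C) (cluster_of C)"

definition simplicial_filtration ::
    "'i::order set \<Rightarrow> ('i \<Rightarrow> 'v set set) \<Rightarrow> ('i \<Rightarrow> 'i \<Rightarrow> 'v \<Rightarrow> 'v) \<Rightarrow> bool" where
  "simplicial_filtration I K \<phi> \<longleftrightarrow>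
     (\<forall>i\<in>I. simplicial_complex (K i)) \<and>
     (\<forall>i\<in>I. \<forall>j\<in>I. i \<le> j \<longrightarrow> simplicial_map (K i) (K j) (\<phi> i j)) \<and>
     (\<forall>i\<in>I. \<forall>j\<in>I. \<forall>l\<in>I. i \<le> j \<and> j \<le> l \<longrightarrow> (\<forall>v\<in>\<Union> (K i). \<phi> j l (\<phi> i j v) = \<phi> i l v))"

section \<open>Simplicial homology with coefficients in an abelian group\<close>

text \<open>A list of the vertices of a \<open>k\<close>-simplex, without repetition, represents an oriented
  \<open>k\<close>-simplex; two orderings give the same orientation iff they differ by an even permutation.
  A \<open>k\<close>-chain is a finitely supported function on oriented \<open>k\<close>-simplices changing sign
  with the orientation, extended by \<open>0\<close> to all other lists. As simplices are nonempty, there are no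
  nonzero chains in negative degrees.\<close>

definition simplicial_chains :: "'v set set \<Rightarrow> int \<Rightarrow> ('v list \<Rightarrow> 'g::ab_group_add) set" where
  "simplicial_chains K k =
     {c. finite {\<sigma>. c \<sigma> \<noteq> 0} \<and>
         (\<forall>\<sigma>. c \<sigma> \<noteq> 0 \<longrightarrow> distinct \<sigma> \<and> set \<sigma> \<in> K \<and> int (length \<sigma>) = k + 1) \<and>
         (\<forall>\<sigma> p. p permutes {..<length \<sigma>} \<longrightarrow>
            c (permute_list p \<sigma>) = (if evenperm p then c \<sigma> else - c \<sigma>))}"

text \<open>The boundary operator is the linear extension of
  \<open>[v\<^sub>0, \<dots>, v\<^sub>k] \<mapsto> \<Sum>i. (-1)^i [v\<^sub>0, \<dots>, v\<^sub>i omitted, \<dots>, v\<^sub>k]\<close>. A simplex having \<open>\<tau>\<close> as the face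
  opposite to a vertex \<open>v\<close> can be oriented as \<open>v # \<tau>\<close>, in which \<open>\<tau>\<close> is omitted-face number \<open>0\<close>; hence
  the coefficient of \<open>\<tau>\<close> is the one below. The case \<open>\<tau> = []\<close> makes the boundary of
  \<open>0\<close>-chains vanish (homology is not reduced).\<close>

definition simplicial_boundary :: "('v list \<Rightarrow> 'g::ab_group_add) \<Rightarrow> 'v list \<Rightarrow> 'g" where
  "simplicial_boundary c \<tau> = (if \<tau> = [] then 0 else \<Sum>v | c (v # \<tau>) \<noteq> 0. c (v # \<tau>))"

text \<open>The chain map of a vertex map \<open>f\<close> is the linear extension of
  \<open>[v\<^sub>0, \<dots>, v\<^sub>k] \<mapsto> [f v\<^sub>0, \<dots>, f v\<^sub>k]\<close>, the latter being \<open>0\<close> if it has a repetition. Every oriented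
  simplex mapped by \<open>f\<close> onto the oriented simplex \<open>\<tau>\<close> or its opposite has exactly one
  ordering whose image is the list \<open>\<tau>\<close>, so each is counted once.\<close>

definition chain_map :: "('v \<Rightarrow> 'w) \<Rightarrow> ('v list \<Rightarrow> 'g::ab_group_add) \<Rightarrow> 'w list \<Rightarrow> 'g" where
  "chain_map f c \<tau> = (if distinct \<tau> then \<Sum>\<sigma> | map f \<sigma> = \<tau> \<and> c \<sigma> \<noteq> 0. c \<sigma> else 0)"

definition simplicial_cycle_group ::
    "'v set set \<Rightarrow> int \<Rightarrow> ('v list \<Rightarrow> 'g::ab_group_add) monoid" where
  "simplicial_cycle_group K k =
     \<lparr>carrier = {c \<in> simplicial_chains K k. \<forall>\<tau>. simplicial_boundary c \<tau> = 0},
      monoid.mult = (\<lambda>c d \<sigma>. c \<sigma> + d \<sigma>), one = (\<lambda>\<sigma>. 0)\<rparr>"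

definition simplicial_boundaries :: "'v set set \<Rightarrow> int \<Rightarrow> ('v list \<Rightarrow> 'g::ab_group_add) set" where
  "simplicial_boundaries K k = simplicial_boundary ` simplicial_chains K (k + 1)"

definition simplicial_homology ::
    "'v set set \<Rightarrow> int \<Rightarrow> ('v list \<Rightarrow> 'g::ab_group_add) set monoid" where
  "simplicial_homology K k = simplicial_cycle_group K k Mod simplicial_boundaries K k"

definition homology_class ::
    "'v set set \<Rightarrow> int \<Rightarrow> ('v list \<Rightarrow> 'g::ab_group_add) \<Rightarrow> ('v list \<Rightarrow> 'g) set" where
  "homology_class K k z = simplicial_boundaries K k #>\<^bsub>simplicial_cycle_group K k\<^esub> z"

definition induced_on_homology ::
    "'v set set \<Rightarrow> 'w set set \<Rightarrow> int \<Rightarrow> ('v \<Rightarrow> 'w)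
       \<Rightarrow> (('v list \<Rightarrow> 'g::ab_group_add) set \<Rightarrow> ('w list \<Rightarrow> 'g) set) \<Rightarrow> bool" where
  "induced_on_homology K L k \<phi> h \<longleftrightarrow>
     (\<forall>z\<in>carrier (simplicial_cycle_group K k).
        chain_map \<phi> z \<in> carrier (simplicial_cycle_group L k) \<and>
        h (homology_class K k z) = homology_class L k (chain_map \<phi> z))"

definition group_filtration ::
    "'i::order set \<Rightarrow> ('i \<Rightarrow> 'h monoid) \<Rightarrow> ('i \<Rightarrow> 'i \<Rightarrow> 'h \<Rightarrow> 'h) \<Rightarrow> bool" where
  "group_filtration I H f \<longleftrightarrow>
     (\<forall>i\<in>I. comm_group (H i)) \<and>
     (\<forall>i\<in>I. \<forall>j\<in>I. i \<le> j \<longrightarrow> f i j \<in> hom (H i) (H j)) \<and>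
     (\<forall>i\<in>I. \<forall>j\<in>I. \<forall>l\<in>I. i \<le> j \<and> j \<le> l \<longrightarrow> (\<forall>x\<in>carrier (H i). f j l (f i j x) = f i l x))"

end

theory Submission
  imports Defs
begin

text \<open>
  Enlarging a bin can only add points to neighbourhoods, so core points stay core and density-reachable
  points stay density-reachable. A cluster \<open>D\<close> of a bin contains a core point \<open>p\<close>, and connectivity
  makes all of \<open>D\<close> density-reachable from \<open>p\<close>. In a larger bin, \<open>p\<close> is again core and hence lies in
  exactly one cluster \<open>E\<close>. It remains to see that \<open>E\<close> absorbs everything reachable from \<open>p\<close>.
  Maximality says this except for points already taken by an earlier cluster. Such a point cannot be
  core, because reachability between core points is symmetric; and a border point taken by an earlier
  cluster while adjacent to a core point of \<open>E\<close> would have two core neighbours in different clusters,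
  which are not density-connected, so it would be a free-border point. Hence, without free-border points,
  every cluster lies in exactly one cluster of the larger bin (\<open>cluster_in_unique_cluster\<close>).

  Uniqueness is what makes the assignment functorial: over \<open>i \<le> j \<le> l\<close> both the composite and the
  direct map send a cluster to a cluster of the same bin that contains it, and there is only one
  (\<open>cluster_cover_filtration\<close>). Taking nerves turns inclusions into simplicial maps, because a point
  common to some sets is common to any sets containing them (\<open>nerve_filtration\<close>).

  The second half is the functoriality of simplicial homology. It rests on two descriptions of the
  coefficient at a list \<open>\<tau>\<close>: for the boundary, with \<open>\<tau>\<close> nonempty, it is a sum over the lists with
  tail \<open>\<tau>\<close>, and for the chain map of \<open>f\<close> a sum over the lists with image \<open>\<tau>\<close>
  under \<open>f\<close>. The latter holds even when \<open>\<tau>\<close> has a repetition, since the sum then cancels in pairs (\<open>chain_map_eq_sum\<close>). With both operators written as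
  sums over fibres, \<open>chain_map_boundary\<close> and \<open>chain_map_comp\<close> become regroupings of one finite sum, and
  \<open>simplicial_boundary_boundary\<close> follows by the same cancellation in pairs. Passing to the
  quotient by the boundaries gives the maps on homology.
\<close>

section \<open>Clusters of nested bins\<close>

lemma density_reachable_step:
  "core_point Y \<epsilon> m p \<Longrightarrow> q \<in> eps_nbhd Y \<epsilon> p \<Longrightarrow> density_reachable Y \<epsilon> m p q"
  unfolding density_reachable_def
  by (rule tranclp.r_into_trancl) (simp add: directly_density_reachable_def)

lemma density_reachable_trans:
  "density_reachable Y \<epsilon> m p q \<Longrightarrow> density_reachable Y \<epsilon> m q r \<Longrightarrow> density_reachable Y \<epsilon> m p r"
  unfolding density_reachable_def by (rule tranclp_trans)

lemma density_reachable_induct [consumes 1, case_names base step]: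
  assumes "density_reachable Y \<epsilon> m p q"
    and "\<And>y. core_point Y \<epsilon> m p \<Longrightarrow> y \<in> eps_nbhd Y \<epsilon> p \<Longrightarrow> P y"
    and "\<And>y z. density_reachable Y \<epsilon> m p y \<Longrightarrow> core_point Y \<epsilon> m y \<Longrightarrow> z \<in> eps_nbhd Y \<epsilon> y
          \<Longrightarrow> P y \<Longrightarrow> P z"
  shows "P q"
  using assms(1) unfolding density_reachable_def
proof (induction rule: tranclp_induct)
  case (base y)
  then have "core_point Y \<epsilon> m p" "y \<in> eps_nbhd Y \<epsilon> p"
    by (simp_all add: directly_density_reachable_def)
  then show ?case by (rule assms(2))
next
  case (step y z)
  then have "core_point Y \<epsilon> m y" "z \<in> eps_nbhd Y \<epsilon> y"
    by (simp_all add: directly_density_reachable_def)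
  then show ?case using step.hyps(1) step.IH assms(3)
    unfolding density_reachable_def by blast
qed

lemma density_reachable_target_mem: "density_reachable Y \<epsilon> m p q \<Longrightarrow> q \<in> Y"
  by (induction rule: density_reachable_induct) (simp_all add: eps_nbhd_def)

lemma density_reachable_last_step:
  assumes "density_reachable Y \<epsilon> m p q"
  shows "\<exists>r. core_point Y \<epsilon> m r \<and> q \<in> eps_nbhd Y \<epsilon> r \<and> (r = p \<or> density_reachable Y \<epsilon> m p r)"
  using assms by (induction rule: density_reachable_induct) blast+

text \<open>Every point of a chain except the last is core by definition; if the last one is core too, then
  each link can be reversed, since the distance is symmetric.\<close>

lemma density_reachable_sym:
  assumes "density_reachable Y \<epsilon> m p q" and "core_point Y \<epsilon> m q"
  shows "density_reachable Y \<epsilon> m q p"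
proof -
  have reverse: "density_reachable Y \<epsilon> m y x"
    if "core_point Y \<epsilon> m x" "y \<in> eps_nbhd Y \<epsilon> x" "core_point Y \<epsilon> m y" for x y
    using that by (intro density_reachable_step) (simp_all add: eps_nbhd_def core_point_def dist_commute)
  show ?thesis
    using assms
  proof (induction rule: density_reachable_induct)
    case (base y)
    then show ?case by (rule reverse)
  next
    case (step y z)
    from reverse[OF step.hyps(2,3) step.prems] step.IH[OF step.hyps(2)]
    show ?case by (rule density_reachable_trans)
  qed
qed

text \<open>The common source of the two chains is core, so the chain leading to the core point \<open>p\<close> can be
  reversed and continued to \<open>q\<close>.\<close>

lemma density_connected_core_imp_reachable:
  assumes "density_connected Y \<epsilon> m p q" and "core_point Y \<epsilon> m p"
  shows "density_reachable Y \<epsilon> m p q"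
proof -
  obtain z where z: "density_reachable Y \<epsilon> m z p" "density_reachable Y \<epsilon> m z q"
    using assms(1) unfolding density_connected_def by blast
  from density_reachable_sym[OF z(1) assms(2)] z(2) show ?thesis
    by (rule density_reachable_trans)
qed

lemma core_point_mono:
  assumes "core_point Y \<epsilon> m p" and "Y \<subseteq> Z" and "finite Z"
  shows "core_point Z \<epsilon> m p"
proof -
  have "card (eps_nbhd Y \<epsilon> p) \<le> card (eps_nbhd Z \<epsilon> p)"
    using assms(2,3) by (intro card_mono) (auto simp: eps_nbhd_def)
  with assms show ?thesis by (auto simp: core_point_def)
qed

lemma density_reachable_mono:
  assumes "density_reachable Y \<epsilon> m p q" and "Y \<subseteq> Z" and "finite Z"
  shows "density_reachable Z \<epsilon> m p q"
proof -
  have nbhd: "eps_nbhd Y \<epsilon> x \<subseteq> eps_nbhd Z \<epsilon> x" for x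
    using assms(2) by (auto simp: eps_nbhd_def)
  have step: "density_reachable Z \<epsilon> m x y" if "core_point Y \<epsilon> m x" "y \<in> eps_nbhd Y \<epsilon> x" for x y
    using that nbhd core_point_mono[OF _ assms(2,3)] by (intro density_reachable_step) auto
  show ?thesis
    using assms(1) by (induction rule: density_reachable_induct) (blast intro: step density_reachable_trans)+
qed

context
  fixes \<epsilon> :: real and m :: nat and Y :: "'a::metric_space set" and Cs :: "'a set list"
  assumes clusters: "dbscan_clusters \<epsilon> m Y Cs"
begin

lemmas cluster_conditions = clusters[unfolded dbscan_clusters_def]
lemmas clusters_pairwise_disjoint =
  cluster_conditions[THEN conjunct1]
lemmas clusters_union_noise =
  cluster_conditions[THEN conjunct2, THEN conjunct2, THEN conjunct1]
lemmas clusters_contain_core =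
  cluster_conditions[THEN conjunct2, THEN conjunct2, THEN conjunct2, THEN conjunct1]
lemmas clusters_maximality =
  cluster_conditions[THEN conjunct2, THEN conjunct2, THEN conjunct2, THEN conjunct2, THEN conjunct1]
lemmas clusters_connectivity =
  cluster_conditions[THEN conjunct2, THEN conjunct2, THEN conjunct2, THEN conjunct2, THEN conjunct2]

lemma clusters_disjoint:
  assumes "i < length Cs" "j < length Cs" "x \<in> Cs ! i" "x \<in> Cs ! j"
  shows "i = j"
  using clusters_pairwise_disjoint assms by (meson disjoint_iff)

lemma cluster_maximal:
  assumes "i < length Cs" "p \<in> Cs ! i" "density_reachable Y \<epsilon> m p q"
    and "\<And>j. j < i \<Longrightarrow> q \<notin> Cs ! j"
  shows "q \<in> Cs ! i"
proof -
  have "q \<notin> (\<Union>j<i. Cs ! j)" using assms(4) by simp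
  then show ?thesis using clusters_maximality assms(1-3) by metis
qed

lemma cluster_core_point:
  assumes "i < length Cs"
  obtains p where "p \<in> Cs ! i" "core_point Y \<epsilon> m p"
  using clusters_contain_core assms by metis

lemma cluster_reachable_from_core:
  assumes "i < length Cs" "p \<in> Cs ! i" "core_point Y \<epsilon> m p" "q \<in> Cs ! i"
  shows "density_reachable Y \<epsilon> m p q"
  using clusters_connectivity assms density_connected_core_imp_reachable by metis

lemma core_in_cluster:
  assumes "core_point Y \<epsilon> m p"
  obtains i where "i < length Cs" "p \<in> Cs ! i"
proof -
  have "p \<in> Y" "p \<notin> noise Y \<epsilon> m" using assms by (auto simp: core_point_def noise_def)
  then have "p \<in> (\<Union>i<length Cs. Cs ! i)" using clusters_union_noise by blast
  then show ?thesis using that by blast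
qed

text \<open>If an earlier cluster had taken \<open>q\<close>, maximality of that cluster, applied along the reversed
  chain, would have put \<open>p\<close> there as well.\<close>

lemma cluster_closed_core:
  assumes i: "i < length Cs" and p: "p \<in> Cs ! i"
    and reach: "density_reachable Y \<epsilon> m p q" and q: "core_point Y \<epsilon> m q"
  shows "q \<in> Cs ! i"
proof (rule cluster_maximal[OF i p reach])
  fix j assume "j < i"
  show "q \<notin> Cs ! j"
  proof
    assume qj: "q \<in> Cs ! j"
    have j: "j < length Cs" using \<open>j < i\<close> i by simp
    have "p \<in> Cs ! j"
    proof (rule cluster_maximal[OF j qj density_reachable_sym[OF reach q]])
      fix l assume "l < j"
      then show "p \<notin> Cs ! l" using clusters_disjoint[OF i _ p, of l] \<open>j < i\<close> i by auto
    qed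
    then show False using clusters_disjoint[OF i j p] \<open>j < i\<close> by simp
  qed
qed

text \<open>This is where free-border points matter: only such points can be withheld by an earlier cluster
  from a later one that reaches them. Suppose \<open>q\<close> is not core and has been taken by an earlier
  cluster. The last core point \<open>r\<close> on the chain from \<open>p\<close> lies in cluster \<open>i\<close>, and the last core point \<open>s\<close> on a chain
  from a core point of the earlier cluster lies in that one. Both are neighbours of \<open>q\<close>, so they are
  density-connected unless \<open>q\<close> is a free-border point, and a connection would merge their clusters.\<close>

lemma cluster_closed_reachable:
  assumes nofree: "\<And>s. \<not> free_border_point Y \<epsilon> m s"
    and i: "i < length Cs" and p: "p \<in> Cs ! i" and reach: "density_reachable Y \<epsilon> m p q"
  shows "q \<in> Cs ! i"
proof (cases "core_point Y \<epsilon> m q")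
  case True
  then show ?thesis by (rule cluster_closed_core[OF i p reach])
next
  case False
  have qY: "q \<in> Y" by (rule density_reachable_target_mem[OF reach])
  have few: "card (eps_nbhd Y \<epsilon> q) < m" using False qY by (simp add: core_point_def)
  have last_core: "\<exists>r. core_point Y \<epsilon> m r \<and> q \<in> eps_nbhd Y \<epsilon> r \<and> r \<in> Cs ! j"
    if j: "j < length Cs" and x: "x \<in> Cs ! j" and reach: "density_reachable Y \<epsilon> m x q" for j x
  proof -
    obtain r where "core_point Y \<epsilon> m r" "q \<in> eps_nbhd Y \<epsilon> r" "r = x \<or> density_reachable Y \<epsilon> m x r"
      using density_reachable_last_step[OF reach] by blast
    then show ?thesis using cluster_closed_core[OF j x] x by blast
  qed
  obtain r where r: "core_point Y \<epsilon> m r" "q \<in> eps_nbhd Y \<epsilon> r" "r \<in> Cs ! i"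
    using last_core[OF i p reach] by blast
  show ?thesis
  proof (rule cluster_maximal[OF i p reach])
    fix j assume "j < i"
    then have j: "j < length Cs" using i by simp
    show "q \<notin> Cs ! j"
    proof
      assume qj: "q \<in> Cs ! j"
      obtain c where c: "c \<in> Cs ! j" "core_point Y \<epsilon> m c" using cluster_core_point[OF j] .
      obtain s where s: "core_point Y \<epsilon> m s" "q \<in> eps_nbhd Y \<epsilon> s" "s \<in> Cs ! j"
        using last_core[OF j c(1) cluster_reachable_from_core[OF j c qj]] by blast
      have "density_connected Y \<epsilon> m r s"
        using nofree[of q] qY few r(1,2) s(1,2) unfolding free_border_point_def by blast
      then have "density_reachable Y \<epsilon> m r s"
        using r(1) by (rule density_connected_core_imp_reachable)
      then have "s \<in> Cs ! i" using s(1) by (rule cluster_closed_core[OF i r(3)])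
      then show False using clusters_disjoint[OF i j _ s(3)] \<open>j < i\<close> by simp
    qed
  qed
qed

end

lemma cluster_in_unique_cluster:
  assumes Cs: "dbscan_clusters \<epsilon> m Y Cs" and Ds: "dbscan_clusters \<epsilon> m Z Ds"
    and YZ: "Y \<subseteq> Z" "finite Z" and nofree: "\<And>s. \<not> free_border_point Z \<epsilon> m s"
    and i: "i < length Cs"
  shows "\<exists>!j. j < length Ds \<and> Cs ! i \<subseteq> Ds ! j"
proof -
  obtain p where p: "p \<in> Cs ! i" "core_point Y \<epsilon> m p" using cluster_core_point[OF Cs i] .
  obtain j where j: "j < length Ds" "p \<in> Ds ! j"
    using core_in_cluster[OF Ds core_point_mono[OF p(2) YZ]] .
  have "Cs ! i \<subseteq> Ds ! j"
    using cluster_closed_reachable[OF Ds nofree j]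
      density_reachable_mono[OF cluster_reachable_from_core[OF Cs i p] YZ] by blast
  then show ?thesis using j p(1) clusters_disjoint[OF Ds] by blast
qed

section \<open>Boundary and chain maps as sums over fibres\<close>

lemma simplicial_chains_finite: "c \<in> simplicial_chains K k \<Longrightarrow> finite {\<sigma>. c \<sigma> \<noteq> 0}"
  by (simp add: simplicial_chains_def)

lemma simplicial_chains_support:
  assumes "c \<in> simplicial_chains K k" "c \<sigma> \<noteq> 0"
  shows "distinct \<sigma>" "set \<sigma> \<in> K" "int (length \<sigma>) = k + 1"
  using assms by (auto simp: simplicial_chains_def)

abbreviation swap_entries :: "nat \<Rightarrow> nat \<Rightarrow> 'a list \<Rightarrow> 'a list" where
  "swap_entries a b \<equiv> permute_list (Transposition.transpose a b)"

lemma transpose_permutes: "a < n \<Longrightarrow> b < n \<Longrightarrow> Transposition.transpose a b permutes {..<n::nat}"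
  by (rule permutes_swap_id) auto

lemma simplicial_chains_swap:
  assumes "c \<in> simplicial_chains K k" "a < length \<sigma>" "b < length \<sigma>" "a \<noteq> b"
  shows "c (swap_entries a b \<sigma>) = - c \<sigma>"
  using assms transpose_permutes[of a "length \<sigma>" b]
  by (simp add: simplicial_chains_def evenperm_swap)

text \<open>Transpositions generate all permutations of positions, so the sign rule need only be checked
  for them. Unlike a general permutation, a transposition is its own inverse and is easily shifted when
  a vertex is put in front of the list.\<close>

lemma simplicial_chainsI:
  assumes fin: "finite {\<sigma>. c \<sigma> \<noteq> 0}"
    and supp: "\<And>\<sigma>. c \<sigma> \<noteq> 0 \<Longrightarrow> distinct \<sigma> \<and> set \<sigma> \<in> K \<and> int (length \<sigma>) = k + 1"
    and swap: "\<And>\<sigma> a b. a < length \<sigma> \<Longrightarrow> b < length \<sigma> \<Longrightarrow> a \<noteq> b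
                \<Longrightarrow> c (swap_entries a b \<sigma>) = - c \<sigma>"
  shows "c \<in> simplicial_chains K k"
proof -
  have "c (permute_list p \<sigma>) = (if evenperm p then c \<sigma> else - c \<sigma>)"
    if "p permutes {..<length \<sigma>}" for p \<sigma>
    using finite_lessThan that
  proof (induction rule: permutes_rev_induct)
    case id
    then show ?case by simp
  next
    case (swap a b p)
    have t: "Transposition.transpose a b permutes {..<length \<sigma>}"
      using swap.hyps by (intro transpose_permutes) auto
    have eq1: "permute_list (p \<circ> Transposition.transpose a b) \<sigma> = swap_entries a b (permute_list p \<sigma>)"
      by (rule permute_list_compose[OF t])
    have eq2: "c (swap_entries a b (permute_list p \<sigma>)) = - c (permute_list p \<sigma>)"
      using swap.hyps by (intro assms(3)) auto
    have ev: "evenperm (p \<circ> Transposition.transpose a b) \<longleftrightarrow> \<not> evenperm p"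
      using swap.hyps by (subst evenperm_comp)
        (auto simp: evenperm_swap permutation_swap_id intro: permutation_permutes[THEN iffD2])
    show ?case unfolding eq1 eq2 ev swap.IH by simp
  qed
  with fin supp show ?thesis by (simp add: simplicial_chains_def)
qed

lemma permute_list_transpose_neq:
  assumes "distinct \<sigma>" "a < length \<sigma>" "b < length \<sigma>" "a \<noteq> b"
  shows "swap_entries a b \<sigma> \<noteq> \<sigma>"
proof
  assume "swap_entries a b \<sigma> = \<sigma>"
  then have "\<sigma> ! b = \<sigma> ! a"
    using permute_list_nth[OF transpose_permutes, of a \<sigma> b a] assms by simp
  then show False using assms by (simp add: nth_eq_iff_index_eq)
qed

lemma permute_list_transpose_involutive:
  assumes "a < length \<sigma>" "b < length \<sigma>"
  shows "swap_entries a b (swap_entries a b \<sigma>) = \<sigma>"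
  using permute_list_compose[OF transpose_permutes[OF assms], of "Transposition.transpose a b"] by simp

text \<open>The cancellation principle behind both \<open>\<partial>\<partial> = 0\<close> and the vanishing of chain maps on degenerate
  images: if swapping two positions preserves the index set, the terms cancel in pairs. The pairing has
  no fixed points because chains live on lists without repetition. Pairing, rather than comparing the
  sum with its negative, is what works for coefficient groups with 2-torsion.\<close>

lemma sum_swap_invariant_eq_0:
  assumes c: "c \<in> simplicial_chains K k" and "a \<noteq> b"
    and P: "\<And>\<sigma>. P \<sigma> \<Longrightarrow> c \<sigma> \<noteq> 0 \<Longrightarrow>
              a < length \<sigma> \<and> b < length \<sigma> \<and> P (swap_entries a b \<sigma>)"
  shows "(\<Sum>\<sigma> | c \<sigma> \<noteq> 0 \<and> P \<sigma>. c \<sigma>) = 0"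
proof (rule sum_involution_eq_0[where h = "swap_entries a b"])
  fix \<sigma> assume "\<sigma> \<in> {\<sigma>. c \<sigma> \<noteq> 0 \<and> P \<sigma>}"
  then have \<sigma>: "c \<sigma> \<noteq> 0" "P \<sigma>" "a < length \<sigma>" "b < length \<sigma>" "P (swap_entries a b \<sigma>)"
    using P by auto
  have swap: "c (swap_entries a b \<sigma>) = - c \<sigma>"
    using simplicial_chains_swap[OF c] \<sigma> \<open>a \<noteq> b\<close> by blast
  show "c (swap_entries a b \<sigma>) + c \<sigma> = 0" by (simp add: swap)
  show "swap_entries a b \<sigma> \<in> {\<sigma>. c \<sigma> \<noteq> 0 \<and> P \<sigma>}" using \<sigma> swap by simp
  show "swap_entries a b (swap_entries a b \<sigma>) = \<sigma>"
    using \<sigma> by (simp add: permute_list_transpose_involutive)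
  show "swap_entries a b \<sigma> \<noteq> \<sigma>"
    using \<sigma> \<open>a \<noteq> b\<close> simplicial_chains_support(1)[OF c] by (intro permute_list_transpose_neq) auto
qed

lemma simplicial_boundary_eq_sum:
  assumes "finite S" "{\<sigma>. c \<sigma> \<noteq> 0} \<subseteq> S" "\<tau> \<noteq> []"
  shows "simplicial_boundary c \<tau> = (\<Sum>\<sigma> | \<sigma> \<in> S \<and> tl \<sigma> = \<tau>. c \<sigma>)"
proof -
  have tl: "tl \<sigma> = \<tau> \<longleftrightarrow> (\<exists>v. \<sigma> = v # \<tau>)" for \<sigma> :: "'a list"
    using assms(3) by (cases \<sigma>) auto
  have "simplicial_boundary c \<tau> = (\<Sum>\<sigma> | c \<sigma> \<noteq> 0 \<and> tl \<sigma> = \<tau>. c \<sigma>)"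
    unfolding simplicial_boundary_def using assms(3)
    by (auto intro!: sum.reindex_bij_witness[where i = hd and j = "\<lambda>v. v # \<tau>"] simp: tl)
  also have "\<dots> = (\<Sum>\<sigma> | \<sigma> \<in> S \<and> tl \<sigma> = \<tau>. c \<sigma>)"
    using assms by (intro sum.mono_neutral_left) auto
  finally show ?thesis .
qed

text \<open>If \<open>\<tau>\<close> has equal entries at positions \<open>a\<close> and \<open>b\<close>, then swapping these positions preserves
  the lists mapped to \<open>\<tau>\<close>, so their coefficients cancel. The enlargement of the support to an arbitrary
  finite \<open>S\<close> lets sums of several chains be taken over a common index set.\<close>

lemma chain_map_eq_sum:
  assumes c: "c \<in> simplicial_chains K k" and S: "finite S" "{\<sigma>. c \<sigma> \<noteq> 0} \<subseteq> S"
  shows "chain_map f c \<tau> = (\<Sum>\<sigma> | \<sigma> \<in> S \<and> map f \<sigma> = \<tau>. c \<sigma>)"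
proof -
  have "chain_map f c \<tau> = (\<Sum>\<sigma> | c \<sigma> \<noteq> 0 \<and> map f \<sigma> = \<tau>. c \<sigma>)"
  proof (cases "distinct \<tau>")
    case True
    then show ?thesis by (simp add: chain_map_def conj_commute)
  next
    case False
    then obtain a b where ab: "a < length \<tau>" "b < length \<tau>" "a \<noteq> b" "\<tau> ! a = \<tau> ! b"
      by (auto simp: distinct_conv_nth)
    have perm: "Transposition.transpose a b permutes {..<length \<tau>}" using ab by (intro transpose_permutes)
    have fixed: "swap_entries a b \<tau> = \<tau>"
      using ab by (intro nth_equalityI) (auto simp: permute_list_nth[OF perm] Transposition.transpose_def)
    have "(\<Sum>\<sigma> | c \<sigma> \<noteq> 0 \<and> map f \<sigma> = \<tau>. c \<sigma>) = 0"
    proof (rule sum_swap_invariant_eq_0[OF c ab(3)])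
      fix \<sigma> assume m: "map f \<sigma> = \<tau>"
      then have "length \<sigma> = length \<tau>" by auto
      with m perm fixed ab
      show "a < length \<sigma> \<and> b < length \<sigma> \<and> map f (swap_entries a b \<sigma>) = \<tau>"
        by (simp flip: permute_list_map)
    qed
    with False show ?thesis by (simp add: chain_map_def)
  qed
  also have "\<dots> = (\<Sum>\<sigma> | \<sigma> \<in> S \<and> map f \<sigma> = \<tau>. c \<sigma>)"
    using S by (intro sum.mono_neutral_left) auto
  finally show ?thesis .
qed

lemma simplicial_boundary_support:
  assumes "simplicial_boundary c \<tau> \<noteq> 0"
  obtains v where "c (v # \<tau>) \<noteq> 0" "\<tau> \<noteq> []"
proof -
  have "\<tau> \<noteq> []" and "(\<Sum>v | c (v # \<tau>) \<noteq> 0. c (v # \<tau>)) \<noteq> 0"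
    using assms by (auto simp: simplicial_boundary_def split: if_splits)
  then show ?thesis using that by (auto elim: sum.not_neutral_contains_not_neutral)
qed

lemma simplicial_boundary_support_subset:
  "{\<tau>. simplicial_boundary c \<tau> \<noteq> 0} \<subseteq> tl ` {\<sigma>. c \<sigma> \<noteq> 0}"
proof
  fix \<tau> assume "\<tau> \<in> {\<tau>. simplicial_boundary c \<tau> \<noteq> 0}"
  then obtain v where "c (v # \<tau>) \<noteq> 0" using simplicial_boundary_support by blast
  then show "\<tau> \<in> tl ` {\<sigma>. c \<sigma> \<noteq> 0}" by (intro image_eqI[of _ _ "v # \<tau>"]) auto
qed

lemma simplicial_boundary_in_chains:
  fixes c :: "'v list \<Rightarrow> 'g::ab_group_add"
  assumes K: "simplicial_complex K" and c: "c \<in> simplicial_chains K (k + 1)"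
  shows "simplicial_boundary c \<in> simplicial_chains K k"
proof (rule simplicial_chainsI)
  show "finite {\<tau>. simplicial_boundary c \<tau> \<noteq> 0}"
    using simplicial_chains_finite[OF c] simplicial_boundary_support_subset by (rule finite_surj)
  fix \<tau> :: "'v list"
  {
    assume "simplicial_boundary c \<tau> \<noteq> 0"
    then obtain v where v: "c (v # \<tau>) \<noteq> 0" and "\<tau> \<noteq> []"
      using simplicial_boundary_support by blast
    have "set \<tau> \<in> K"
      using simplicial_chains_support(2)[OF c v] K \<open>\<tau> \<noteq> []\<close>
      unfolding simplicial_complex_def by (metis set_empty set_subset_Cons)
    then show "distinct \<tau> \<and> set \<tau> \<in> K \<and> int (length \<tau>) = k + 1"
      using simplicial_chains_support[OF c v] by auto
  }
  fix a b assume ab: "a < length \<tau>" "b < length \<tau>" "a \<noteq> b"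
  \<comment> \<open>A swap of positions in \<open>\<tau>\<close> is the swap of the successor positions in any coface \<open>v # \<tau>\<close>.\<close>
  have shift: "v # swap_entries a b \<tau>
      = swap_entries (Suc a) (Suc b) (v # \<tau>)" for v
    using ab transpose_permutes[of a "length \<tau>" b]
      transpose_permutes[of "Suc a" "length (v # \<tau>)" "Suc b"]
    by (intro nth_equalityI) (auto simp: permute_list_nth nth_Cons Transposition.transpose_def split: nat.splits)
  have neg: "c (v # swap_entries a b \<tau>) = - c (v # \<tau>)" for v
    unfolding shift using ab by (intro simplicial_chains_swap[OF c]) auto
  have "swap_entries a b \<tau> = [] \<longleftrightarrow> \<tau> = []"
    by (metis length_0_conv length_permute_list)
  then show "simplicial_boundary c (swap_entries a b \<tau>) = - simplicial_boundary c \<tau>"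
    by (simp add: simplicial_boundary_def neg sum_negf)
qed

text \<open>The coefficient at a nonempty \<open>\<tau>\<close> is the sum over all lists \<open>v # w # \<tau>\<close>, a set preserved by swapping the two
  leading vertices.\<close>

lemma simplicial_boundary_boundary:
  assumes K: "simplicial_complex K" and c: "c \<in> simplicial_chains K k"
  shows "simplicial_boundary (simplicial_boundary c) \<tau> = 0"
proof (cases "\<tau> = []")
  case True
  then show ?thesis by (simp add: simplicial_boundary_def)
next
  case False
  let ?S = "{\<sigma>. c \<sigma> \<noteq> 0}"
  have fin: "finite ?S" by (rule simplicial_chains_finite[OF c])
  have boundary: "simplicial_boundary c \<rho> = (\<Sum>\<sigma> | \<sigma> \<in> ?S \<and> tl \<sigma> = \<rho>. c \<sigma>)" if "\<rho> \<noteq> []" for \<rho>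
    using that by (intro simplicial_boundary_eq_sum[OF fin]) auto
  have "{\<rho>. simplicial_boundary c \<rho> \<noteq> 0} \<subseteq> tl ` ?S"
    by (rule simplicial_boundary_support_subset)
  then have "simplicial_boundary (simplicial_boundary c) \<tau>
      = (\<Sum>\<rho> | \<rho> \<in> tl ` ?S \<and> tl \<rho> = \<tau>. simplicial_boundary c \<rho>)"
    using fin False by (intro simplicial_boundary_eq_sum) auto
  also have "\<dots> = (\<Sum>\<rho> | \<rho> \<in> tl ` ?S \<and> tl \<rho> = \<tau>.
      \<Sum>\<sigma> | \<sigma> \<in> {\<sigma>. c \<sigma> \<noteq> 0 \<and> tl (tl \<sigma>) = \<tau>} \<and> tl \<sigma> = \<rho>. c \<sigma>)"
  proof (intro sum.cong refl)
    fix \<rho> assume \<rho>: "\<rho> \<in> {\<rho>. \<rho> \<in> tl ` ?S \<and> tl \<rho> = \<tau>}"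
    then have ne: "\<rho> \<noteq> []" using False by auto
    have eq: "{\<sigma>. \<sigma> \<in> ?S \<and> tl \<sigma> = \<rho>}
        = {\<sigma>. \<sigma> \<in> {\<sigma>. c \<sigma> \<noteq> 0 \<and> tl (tl \<sigma>) = \<tau>} \<and> tl \<sigma> = \<rho>}"
      using \<rho> by auto
    show "simplicial_boundary c \<rho>
        = (\<Sum>\<sigma> | \<sigma> \<in> {\<sigma>. c \<sigma> \<noteq> 0 \<and> tl (tl \<sigma>) = \<tau>} \<and> tl \<sigma> = \<rho>. c \<sigma>)"
      unfolding boundary[OF ne] eq ..
  qed
  also have "\<dots> = (\<Sum>\<sigma> | c \<sigma> \<noteq> 0 \<and> tl (tl \<sigma>) = \<tau>. c \<sigma>)"
    using fin by (intro sum.group) auto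
  also have "\<dots> = 0"
  proof (rule sum_swap_invariant_eq_0[OF c])
    show "(0::nat) \<noteq> 1" by simp
    fix \<sigma> assume "tl (tl \<sigma>) = \<tau>"
    then obtain v w where \<sigma>: "\<sigma> = v # w # \<tau>"
      using False by (cases \<sigma>; cases "tl \<sigma>") auto
    have "swap_entries 0 1 \<sigma> = w # v # \<tau>"
      using transpose_permutes[of 0 "length \<sigma>" 1] unfolding \<sigma>
      by (intro nth_equalityI) (auto simp: permute_list_nth nth_Cons Transposition.transpose_def split: nat.splits)
    then show "0 < length \<sigma> \<and> 1 < length \<sigma> \<and> tl (tl (swap_entries 0 1 \<sigma>)) = \<tau>"
      using \<sigma> by simp
  qed
  finally show ?thesis .
qed

lemma chain_map_support:
  assumes "chain_map f c \<tau> \<noteq> 0"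
  obtains \<sigma> where "c \<sigma> \<noteq> 0" "\<tau> = map f \<sigma>" "distinct \<tau>"
proof -
  have "distinct \<tau>" and "(\<Sum>\<sigma> | map f \<sigma> = \<tau> \<and> c \<sigma> \<noteq> 0. c \<sigma>) \<noteq> 0"
    using assms by (auto simp: chain_map_def split: if_splits)
  then show ?thesis using that by (auto elim: sum.not_neutral_contains_not_neutral)
qed

lemma chain_map_in_chains:
  fixes f :: "'v \<Rightarrow> 'w"
  assumes c: "c \<in> simplicial_chains K k" and f: "simplicial_map K L f"
  shows "chain_map f c \<in> simplicial_chains L k"
proof (rule simplicial_chainsI)
  let ?S = "{\<sigma>. c \<sigma> \<noteq> 0}"
  have "{\<tau>. chain_map f c \<tau> \<noteq> 0} \<subseteq> map f ` ?S"
    by (auto elim!: chain_map_support)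
  then show "finite {\<tau>. chain_map f c \<tau> \<noteq> 0}"
    using simplicial_chains_finite[OF c] finite_surj by blast
  fix \<tau>
  show "distinct \<tau> \<and> set \<tau> \<in> L \<and> int (length \<tau>) = k + 1" if "chain_map f c \<tau> \<noteq> 0"
    using chain_map_support[OF that] simplicial_chains_support[OF c] f
    unfolding simplicial_map_def by (metis length_map list.set_map)
  fix a b assume ab: "a < length \<tau>" "b < length \<tau>" "a \<noteq> b"
  let ?t = "swap_entries a b"
  have perm: "Transposition.transpose a b permutes {..<length \<tau>}" using ab by (intro transpose_permutes)
  have neg: "c (?t \<sigma>) = - c \<sigma>" if "length \<sigma> = length \<tau>" for \<sigma>
    using that ab by (intro simplicial_chains_swap[OF c]) auto
  have inv: "?t (?t \<sigma>) = \<sigma>" if "length \<sigma> = length \<tau>" for \<sigma> :: "'v list"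
    using that ab by (intro permute_list_transpose_involutive) auto
  have map: "map f (?t \<sigma>) = ?t (map f \<sigma>)" if "length \<sigma> = length \<tau>" for \<sigma>
    using that perm by (simp add: permute_list_map)
  have inv': "?t (?t \<tau>) = \<tau>" using ab by (intro permute_list_transpose_involutive) auto
  \<comment> \<open>Swapping positions matches the lists over the swapped \<open>\<tau>\<close> with those over \<open>\<tau>\<close>.\<close>
  have "(\<Sum>\<sigma> | map f \<sigma> = ?t \<tau> \<and> c \<sigma> \<noteq> 0. c \<sigma>) = (\<Sum>\<sigma> | map f \<sigma> = \<tau> \<and> c \<sigma> \<noteq> 0. - c \<sigma>)"
  proof (rule sum.reindex_bij_witness[where i = ?t and j = ?t])
    fix \<sigma> assume \<sigma>: "\<sigma> \<in> {\<sigma>. map f \<sigma> = ?t \<tau> \<and> c \<sigma> \<noteq> 0}"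
    then have len: "length \<sigma> = length \<tau>" by (metis (mono_tags) length_map length_permute_list mem_Collect_eq)
    show "?t (?t \<sigma>) = \<sigma>" by (rule inv[OF len])
    show "?t \<sigma> \<in> {\<sigma>. map f \<sigma> = \<tau> \<and> c \<sigma> \<noteq> 0}" using \<sigma> by (simp add: map[OF len] neg[OF len] inv')
    show "- c (?t \<sigma>) = c \<sigma>" by (simp add: neg[OF len])
  next
    fix \<sigma> assume \<sigma>: "\<sigma> \<in> {\<sigma>. map f \<sigma> = \<tau> \<and> c \<sigma> \<noteq> 0}"
    then have len: "length \<sigma> = length \<tau>" by auto
    show "?t (?t \<sigma>) = \<sigma>" by (rule inv[OF len])
    show "?t \<sigma> \<in> {\<sigma>. map f \<sigma> = ?t \<tau> \<and> c \<sigma> \<noteq> 0}" using \<sigma> by (simp add: map[OF len] neg[OF len])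
  qed
  then show "chain_map f c (?t \<tau>) = - chain_map f c \<tau>"
    using perm by (simp add: chain_map_def sum_negf)
qed

text \<open>At a nonempty \<open>\<tau>\<close>, both sides are the sum over all lists whose tail is mapped to \<open>\<tau>\<close>: grouping these lists by their
  tail gives the left side, grouping them by their image gives the right side. The second grouping
  includes images \<open>w # \<tau>\<close> with \<open>w\<close> already in \<open>\<tau>\<close>, which is why \<open>chain_map_eq_sum\<close> is needed for lists
  with repetitions.\<close>

lemma chain_map_boundary:
  fixes f :: "'v \<Rightarrow> 'w"
  assumes K: "simplicial_complex K" and c: "c \<in> simplicial_chains K k"
    and f: "simplicial_map K L f"
  shows "chain_map f (simplicial_boundary c) = simplicial_boundary (chain_map f c)"
proof
  fix \<tau> :: "'w list"
  let ?S = "{\<sigma>. c \<sigma> \<noteq> 0}"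
  have fin: "finite ?S" by (rule simplicial_chains_finite[OF c])
  have bc: "simplicial_boundary c \<in> simplicial_chains K (k - 1)"
    using c by (intro simplicial_boundary_in_chains[OF K]) simp
  have supp: "{\<rho>. simplicial_boundary c \<rho> \<noteq> 0} \<subseteq> tl ` ?S"
    by (rule simplicial_boundary_support_subset)
  show "chain_map f (simplicial_boundary c) \<tau> = simplicial_boundary (chain_map f c) \<tau>"
  proof (cases "\<tau> = []")
    case True
    then show ?thesis by (auto simp: simplicial_boundary_def chain_map_def)
  next
    case False
    have "chain_map f (simplicial_boundary c) \<tau>
        = (\<Sum>\<rho> | \<rho> \<in> tl ` ?S \<and> map f \<rho> = \<tau>. simplicial_boundary c \<rho>)"
      using fin supp by (intro chain_map_eq_sum[OF bc]) auto
    also have "\<dots> = (\<Sum>\<rho> | \<rho> \<in> tl ` ?S \<and> map f \<rho> = \<tau>.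
        \<Sum>\<sigma> | \<sigma> \<in> {\<sigma>. c \<sigma> \<noteq> 0 \<and> map f (tl \<sigma>) = \<tau>} \<and> tl \<sigma> = \<rho>. c \<sigma>)"
      using False fin
      by (intro sum.cong refl, subst simplicial_boundary_eq_sum[OF fin]) (auto intro!: sum.cong)
    also have "\<dots> = (\<Sum>\<sigma> | c \<sigma> \<noteq> 0 \<and> map f (tl \<sigma>) = \<tau>. c \<sigma>)"
      using fin by (intro sum.group) auto
    also have "\<dots> = (\<Sum>\<rho> | \<rho> \<in> map f ` ?S \<and> tl \<rho> = \<tau>.
        \<Sum>\<sigma> | \<sigma> \<in> {\<sigma>. c \<sigma> \<noteq> 0 \<and> map f (tl \<sigma>) = \<tau>} \<and> map f \<sigma> = \<rho>. c \<sigma>)"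
      using fin by (intro sum.group[symmetric]) (auto simp: map_tl)
    also have "\<dots> = (\<Sum>\<rho> | \<rho> \<in> map f ` ?S \<and> tl \<rho> = \<tau>. chain_map f c \<rho>)"
      by (intro sum.cong refl, subst chain_map_eq_sum[OF c fin]) (auto intro!: sum.cong simp: map_tl)
    also have "\<dots> = simplicial_boundary (chain_map f c) \<tau>"
      using fin False
      by (intro simplicial_boundary_eq_sum[symmetric]) (auto elim!: chain_map_support)
    finally show ?thesis .
  qed
qed

text \<open>Both sides are the sum over all lists with image \<open>\<tau>\<close>, on the left grouped by their image under
  \<open>f\<close>. The maps are compared on the vertices of \<open>K\<close> because a filtration of complexes fixes its
  composition law only there.\<close>

lemma chain_map_comp:
  fixes f :: "'v \<Rightarrow> 'w" and g :: "'w \<Rightarrow> 'x"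
  assumes c: "c \<in> simplicial_chains K k" and f: "simplicial_map K L f"
    and h: "\<And>v. v \<in> \<Union> K \<Longrightarrow> g (f v) = h v"
  shows "chain_map g (chain_map f c) = chain_map h c"
proof
  fix \<tau> :: "'x list"
  let ?S = "{\<sigma>. c \<sigma> \<noteq> 0}"
  have fin: "finite ?S" by (rule simplicial_chains_finite[OF c])
  have map: "map g (map f \<sigma>) = map h \<sigma>" if "c \<sigma> \<noteq> 0" for \<sigma>
    using h simplicial_chains_support(2)[OF c that] by auto
  have "chain_map g (chain_map f c) \<tau>
      = (\<Sum>\<rho> | \<rho> \<in> map f ` ?S \<and> map g \<rho> = \<tau>. chain_map f c \<rho>)"
    using fin by (intro chain_map_eq_sum[OF chain_map_in_chains[OF c f]]) (auto elim!: chain_map_support)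
  also have "\<dots> = (\<Sum>\<rho> | \<rho> \<in> map f ` ?S \<and> map g \<rho> = \<tau>.
      \<Sum>\<sigma> | \<sigma> \<in> {\<sigma>. c \<sigma> \<noteq> 0 \<and> map h \<sigma> = \<tau>} \<and> map f \<sigma> = \<rho>. c \<sigma>)"
  proof (intro sum.cong refl)
    fix \<rho> assume \<rho>: "\<rho> \<in> {\<rho>. \<rho> \<in> map f ` ?S \<and> map g \<rho> = \<tau>}"
    have "chain_map f c \<rho> = (\<Sum>\<sigma> | \<sigma> \<in> ?S \<and> map f \<sigma> = \<rho>. c \<sigma>)"
      by (intro chain_map_eq_sum[OF c fin]) simp
    moreover have "map h \<sigma> = \<tau>" if "c \<sigma> \<noteq> 0" "map f \<sigma> = \<rho>" for \<sigma>
    proof -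
      have "map g \<rho> = map h \<sigma>" using map[OF that(1)] unfolding that(2) .
      then show ?thesis using \<rho> by simp
    qed
    then have "{\<sigma>. \<sigma> \<in> ?S \<and> map f \<sigma> = \<rho>}
        = {\<sigma>. \<sigma> \<in> {\<sigma>. c \<sigma> \<noteq> 0 \<and> map h \<sigma> = \<tau>} \<and> map f \<sigma> = \<rho>}"
      by blast
    ultimately show "chain_map f c \<rho>
        = (\<Sum>\<sigma> | \<sigma> \<in> {\<sigma>. c \<sigma> \<noteq> 0 \<and> map h \<sigma> = \<tau>} \<and> map f \<sigma> = \<rho>. c \<sigma>)"
      by simp
  qed
  also have "\<dots> = (\<Sum>\<sigma> | c \<sigma> \<noteq> 0 \<and> map h \<sigma> = \<tau>. c \<sigma>)"
    using fin map by (intro sum.group) fastforce+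
  also have "\<dots> = chain_map h c \<tau>"
    by (subst chain_map_eq_sum[OF c fin]) auto
  finally show "chain_map g (chain_map f c) \<tau> = chain_map h c \<tau>" .
qed

section \<open>Homology as a functor\<close>

lemma simplicial_chains_zero: "(\<lambda>\<sigma>. 0) \<in> simplicial_chains K k"
  by (auto simp: simplicial_chains_def)

lemma simplicial_chains_add:
  assumes "c \<in> simplicial_chains K k" "d \<in> simplicial_chains K k"
  shows "(\<lambda>\<sigma>. c \<sigma> + d \<sigma>) \<in> simplicial_chains K k"
proof (rule simplicial_chainsI)
  show "finite {\<sigma>. c \<sigma> + d \<sigma> \<noteq> 0}"
    by (rule finite_subset[of _ "{\<sigma>. c \<sigma> \<noteq> 0} \<union> {\<sigma>. d \<sigma> \<noteq> 0}"])
      (use assms in \<open>auto dest: simplicial_chains_finite\<close>)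
  show "distinct \<sigma> \<and> set \<sigma> \<in> K \<and> int (length \<sigma>) = k + 1" if "c \<sigma> + d \<sigma> \<noteq> 0" for \<sigma>
  proof -
    have "c \<sigma> \<noteq> 0 \<or> d \<sigma> \<noteq> 0" using that by auto
    then show ?thesis using assms simplicial_chains_support by metis
  qed
qed (simp add: simplicial_chains_swap[OF assms(1)] simplicial_chains_swap[OF assms(2)])

lemma simplicial_chains_uminus:
  assumes "c \<in> simplicial_chains K k"
  shows "(\<lambda>\<sigma>. - c \<sigma>) \<in> simplicial_chains K k"
  using assms by (auto simp: simplicial_chains_def)

lemma simplicial_boundary_add:
  assumes "c \<in> simplicial_chains K k" "d \<in> simplicial_chains K k"
  shows "simplicial_boundary (\<lambda>\<sigma>. c \<sigma> + d \<sigma>) = (\<lambda>\<tau>. simplicial_boundary c \<tau> + simplicial_boundary d \<tau>)"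
proof
  fix \<tau> :: "'a list"
  let ?S = "{\<sigma>. c \<sigma> \<noteq> 0} \<union> {\<sigma>. d \<sigma> \<noteq> 0}"
  have S: "finite ?S" using assms by (auto dest: simplicial_chains_finite)
  show "simplicial_boundary (\<lambda>\<sigma>. c \<sigma> + d \<sigma>) \<tau> = simplicial_boundary c \<tau> + simplicial_boundary d \<tau>"
  proof (cases "\<tau> = []")
    case True
    then show ?thesis by (simp add: simplicial_boundary_def)
  next
    case False
    have sub: "{\<sigma>. c \<sigma> \<noteq> 0} \<subseteq> ?S" "{\<sigma>. d \<sigma> \<noteq> 0} \<subseteq> ?S" "{\<sigma>. c \<sigma> + d \<sigma> \<noteq> 0} \<subseteq> ?S" by auto
    show ?thesis
      unfolding sub[THEN simplicial_boundary_eq_sum[OF S _ False]] by (rule sum.distrib)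
  qed
qed

lemma simplicial_boundary_uminus:
  "simplicial_boundary (\<lambda>\<sigma>. - c \<sigma>) = (\<lambda>\<tau>. - simplicial_boundary c \<tau>)"
  by (auto simp: simplicial_boundary_def sum_negf)

lemma chain_map_add:
  assumes "c \<in> simplicial_chains K k" "d \<in> simplicial_chains K k"
  shows "chain_map f (\<lambda>\<sigma>. c \<sigma> + d \<sigma>) = (\<lambda>\<tau>. chain_map f c \<tau> + chain_map f d \<tau>)"
proof
  fix \<tau>
  let ?S = "{\<sigma>. c \<sigma> \<noteq> 0} \<union> {\<sigma>. d \<sigma> \<noteq> 0}"
  have S: "finite ?S" using assms by (auto dest: simplicial_chains_finite)
  have sub: "{\<sigma>. c \<sigma> \<noteq> 0} \<subseteq> ?S" "{\<sigma>. d \<sigma> \<noteq> 0} \<subseteq> ?S" "{\<sigma>. c \<sigma> + d \<sigma> \<noteq> 0} \<subseteq> ?S" by auto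
  show "chain_map f (\<lambda>\<sigma>. c \<sigma> + d \<sigma>) \<tau> = chain_map f c \<tau> + chain_map f d \<tau>"
    unfolding chain_map_eq_sum[OF assms(1) S sub(1)] chain_map_eq_sum[OF assms(2) S sub(2)]
      chain_map_eq_sum[OF simplicial_chains_add[OF assms] S sub(3)]
    by (rule sum.distrib)
qed

lemma cycle_group_simps [simp]:
  "x \<otimes>\<^bsub>simplicial_cycle_group K k\<^esub> y = (\<lambda>\<sigma>. x \<sigma> + y \<sigma>)"
  "\<one>\<^bsub>simplicial_cycle_group K k\<^esub> = (\<lambda>\<sigma>. 0)"
  by (simp_all add: simplicial_cycle_group_def)

lemma mem_cycle_group:
  "z \<in> carrier (simplicial_cycle_group K k)
    \<longleftrightarrow> z \<in> simplicial_chains K k \<and> (\<forall>\<tau>. simplicial_boundary z \<tau> = 0)"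
  by (simp add: simplicial_cycle_group_def)

lemma cycle_uminus:
  "z \<in> carrier (simplicial_cycle_group K k) \<Longrightarrow> (\<lambda>\<sigma>. - z \<sigma>) \<in> carrier (simplicial_cycle_group K k)"
  by (simp add: mem_cycle_group simplicial_chains_uminus simplicial_boundary_uminus)

lemma cycle_group_comm_group:
  "comm_group (simplicial_cycle_group K k :: ('v list \<Rightarrow> 'g::ab_group_add) monoid)"
proof (rule comm_groupI)
  let ?Z = "simplicial_cycle_group K k :: ('v list \<Rightarrow> 'g) monoid"
  fix x y assume x: "x \<in> carrier ?Z" and y: "y \<in> carrier ?Z"
  then show "x \<otimes>\<^bsub>?Z\<^esub> y \<in> carrier ?Z"
    by (auto simp: mem_cycle_group simplicial_chains_add simplicial_boundary_add)
  show "\<exists>w\<in>carrier ?Z. w \<otimes>\<^bsub>?Z\<^esub> x = \<one>\<^bsub>?Z\<^esub>"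
    using cycle_uminus[OF x] by (intro bexI) auto
qed (auto simp: mem_cycle_group simplicial_chains_zero simplicial_boundary_def add_ac)

lemma cycle_group_inv:
  assumes "z \<in> carrier (simplicial_cycle_group K k)"
  shows "inv\<^bsub>simplicial_cycle_group K k\<^esub> z = (\<lambda>\<sigma>. - z \<sigma>)"
proof -
  interpret comm_group "simplicial_cycle_group K k" by (rule cycle_group_comm_group)
  show ?thesis using assms cycle_uminus[OF assms] by (intro inv_equality) auto
qed

lemma boundaries_subgroup:
  assumes K: "simplicial_complex K"
  shows "subgroup (simplicial_boundaries K k :: ('v list \<Rightarrow> 'g::ab_group_add) set) (simplicial_cycle_group K k)"
proof
  let ?Z = "simplicial_cycle_group K k :: ('v list \<Rightarrow> 'g) monoid"
  let ?B = "simplicial_boundaries K k :: ('v list \<Rightarrow> 'g) set"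
  show sub: "?B \<subseteq> carrier ?Z"
    using simplicial_boundary_in_chains[OF K] simplicial_boundary_boundary[OF K]
    by (auto simp: simplicial_boundaries_def mem_cycle_group)
  show "x \<otimes>\<^bsub>?Z\<^esub> y \<in> ?B" if "x \<in> ?B" "y \<in> ?B" for x y
    using that unfolding simplicial_boundaries_def
    by (auto simp flip: simplicial_boundary_add intro!: imageI simplicial_chains_add)
  have "(\<lambda>\<tau>. 0) = simplicial_boundary (\<lambda>\<sigma>::'v list. 0::'g)"
    by (auto simp: simplicial_boundary_def)
  then show "\<one>\<^bsub>?Z\<^esub> \<in> ?B"
    using simplicial_chains_zero unfolding simplicial_boundaries_def by auto
  show "inv\<^bsub>?Z\<^esub> x \<in> ?B" if "x \<in> ?B" for x
    using that sub cycle_group_inv[of x K k] unfolding simplicial_boundaries_def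
    by (auto simp flip: simplicial_boundary_uminus intro!: imageI simplicial_chains_uminus)
qed

lemma boundaries_normal:
  "simplicial_complex K \<Longrightarrow> simplicial_boundaries K k \<lhd> simplicial_cycle_group K k"
  by (rule comm_group.subgroup_imp_normal[OF cycle_group_comm_group boundaries_subgroup])

lemma homology_comm_group: "simplicial_complex K \<Longrightarrow> comm_group (simplicial_homology K k)"
  unfolding simplicial_homology_def
  by (rule comm_group.abelian_FactGroup[OF cycle_group_comm_group boundaries_subgroup])

lemma chain_map_cycle:
  assumes K: "simplicial_complex K" and f: "simplicial_map K L f"
    and z: "z \<in> carrier (simplicial_cycle_group K k)"
  shows "chain_map f z \<in> carrier (simplicial_cycle_group L k)"
proof -
  have z': "z \<in> simplicial_chains K k" and "simplicial_boundary z = (\<lambda>\<tau>. 0)"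
    using z by (auto simp: mem_cycle_group)
  then have "simplicial_boundary (chain_map f z) = (\<lambda>\<tau>. 0)"
    by (auto simp flip: chain_map_boundary[OF K z' f] simp: chain_map_def)
  then show ?thesis using chain_map_in_chains[OF z' f] by (simp add: mem_cycle_group)
qed

text \<open>Two homologous cycles differ by a boundary, whose image is again a boundary; so the class of the
  image depends only on the class, and the universal property of the quotient applies.\<close>

lemma induced_on_homology_exists:
  fixes K :: "'v set set" and L :: "'w set set"
  assumes K: "simplicial_complex K" and L: "simplicial_complex L" and f: "simplicial_map K L f"
  shows "\<exists>h :: ('v list \<Rightarrow> 'g::ab_group_add) set \<Rightarrow> ('w list \<Rightarrow> 'g) set.
     h \<in> hom (simplicial_homology K k) (simplicial_homology L k) \<and> induced_on_homology K L k f h"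
proof -
  let ?ZK = "simplicial_cycle_group K k :: ('v list \<Rightarrow> 'g) monoid"
  let ?ZL = "simplicial_cycle_group L k :: ('w list \<Rightarrow> 'g) monoid"
  let ?BK = "simplicial_boundaries K k :: ('v list \<Rightarrow> 'g) set"
  let ?BL = "simplicial_boundaries L k :: ('w list \<Rightarrow> 'g) set"
  interpret ZK: comm_group ?ZK by (rule cycle_group_comm_group)
  interpret ZL: comm_group ?ZL by (rule cycle_group_comm_group)
  interpret NL: normal ?BL ?ZL by (rule boundaries_normal[OF L])
  have cyc: "chain_map f z \<in> carrier ?ZL" if "z \<in> carrier ?ZK" for z
    using chain_map_cycle[OF K f that] .
  have add: "chain_map f (y \<otimes>\<^bsub>?ZK\<^esub> z) = chain_map f y \<otimes>\<^bsub>?ZL\<^esub> chain_map f z"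
    if "y \<in> carrier ?ZK" "z \<in> carrier ?ZK" for y z
    using that chain_map_add[of y K k z f] by (simp add: mem_cycle_group)
  have "chain_map f \<in> hom ?ZK ?ZL"
    using cyc add by (auto intro: homI)
  then have hom: "homology_class L k \<circ> chain_map f \<in> hom ?ZK (?ZL Mod ?BL)"
    using NL.r_coset_hom_Mod unfolding homology_class_def by (rule hom_compose)
  have wd: "(homology_class L k \<circ> chain_map f) y = (homology_class L k \<circ> chain_map f) z"
    if y: "y \<in> carrier ?ZK" and z: "z \<in> carrier ?ZK"
      and eq: "?BK #>\<^bsub>?ZK\<^esub> y = ?BK #>\<^bsub>?ZK\<^esub> z" for y z
  proof -
    have "z \<in> ?BK #>\<^bsub>?ZK\<^esub> y"
      using ZK.repr_independenceD[OF boundaries_subgroup[OF K] z eq] .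
    then obtain c where c: "c \<in> simplicial_chains K (k + 1)"
        and zc: "z = simplicial_boundary c \<otimes>\<^bsub>?ZK\<^esub> y"
      by (auto simp: r_coset_def simplicial_boundaries_def)
    have "simplicial_boundary c \<in> carrier ?ZK"
      using c subgroup.subset[OF boundaries_subgroup[OF K]]
      by (auto simp: simplicial_boundaries_def)
    then have "chain_map f z = simplicial_boundary (chain_map f c) \<otimes>\<^bsub>?ZL\<^esub> chain_map f y"
      unfolding zc using add[OF _ y] chain_map_boundary[OF K c f] by simp
    moreover have "simplicial_boundary (chain_map f c) \<in> ?BL"
      using chain_map_in_chains[OF c f] by (auto simp: simplicial_boundaries_def)
    ultimately have "chain_map f z \<in> ?BL #>\<^bsub>?ZL\<^esub> chain_map f y"
      using ZL.rcosI NL.subset cyc[OF y] by metis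
    then show ?thesis
      unfolding homology_class_def comp_def
      using ZL.repr_independence[OF _ cyc[OF y] boundaries_subgroup[OF L]] by blast
  qed
  obtain h where "h \<in> hom (?ZK Mod ?BK) (?ZL Mod ?BL)"
      and "\<And>z. z \<in> carrier ?ZK \<Longrightarrow> h (?BK #>\<^bsub>?ZK\<^esub> z) = (homology_class L k \<circ> chain_map f) z"
    using FactGroup_universal[OF hom boundaries_normal[OF K] wd] by blast
  then show ?thesis
    using cyc unfolding simplicial_homology_def induced_on_homology_def
    by (intro exI[of _ h]) (auto simp: homology_class_def)
qed

text \<open>The maps on homology are chosen independently for every pair \<open>i \<le> j\<close>. They nevertheless compose,
  because being induced determines their values on the class of every cycle.\<close>

lemma simplicial_filtration_homology:
  fixes K :: "'i::order \<Rightarrow> 'v set set"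
  assumes \<phi>: "simplicial_filtration I K \<phi>"
  shows "\<exists>f :: 'i \<Rightarrow> 'i \<Rightarrow> ('v list \<Rightarrow> 'g::ab_group_add) set \<Rightarrow> ('v list \<Rightarrow> 'g) set.
     group_filtration I (\<lambda>i. simplicial_homology (K i) k) f \<and>
     (\<forall>i\<in>I. \<forall>j\<in>I. i \<le> j \<longrightarrow> induced_on_homology (K i) (K j) k (\<phi> i j) (f i j))"
proof -
  have K: "simplicial_complex (K i)" if "i \<in> I" for i
    using \<phi> that by (simp add: simplicial_filtration_def)
  have map: "simplicial_map (K i) (K j) (\<phi> i j)" if "i \<in> I" "j \<in> I" "i \<le> j" for i j
    using \<phi> that by (simp add: simplicial_filtration_def)
  have "\<forall>i j. \<exists>h :: ('v list \<Rightarrow> 'g) set \<Rightarrow> ('v list \<Rightarrow> 'g) set. i \<in> I \<longrightarrow> j \<in> I \<longrightarrow> i \<le> j \<longrightarrow>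
      h \<in> hom (simplicial_homology (K i) k) (simplicial_homology (K j) k) \<and>
      induced_on_homology (K i) (K j) k (\<phi> i j) h"
    using induced_on_homology_exists[OF K K map] by blast
  then obtain f :: "'i \<Rightarrow> 'i \<Rightarrow> ('v list \<Rightarrow> 'g) set \<Rightarrow> ('v list \<Rightarrow> 'g) set" where
    hom: "\<And>i j. i \<in> I \<Longrightarrow> j \<in> I \<Longrightarrow> i \<le> j \<Longrightarrow>
        f i j \<in> hom (simplicial_homology (K i) k) (simplicial_homology (K j) k)" and
    ind: "\<And>i j. i \<in> I \<Longrightarrow> j \<in> I \<Longrightarrow> i \<le> j \<Longrightarrow> induced_on_homology (K i) (K j) k (\<phi> i j) (f i j)"
    by metis
  have "f j l (f i j x) = f i l x"
    if I: "i \<in> I" "j \<in> I" "l \<in> I" and le: "i \<le> j" "j \<le> l"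
      and x: "x \<in> carrier (simplicial_homology (K i) k)" for i j l x
  proof -
    obtain z where z: "z \<in> carrier (simplicial_cycle_group (K i) k)" and
      xz: "x = homology_class (K i) k z"
      using x by (auto simp: simplicial_homology_def carrier_FactGroup homology_class_def)
    have comp: "chain_map (\<phi> j l) (chain_map (\<phi> i j) z) = chain_map (\<phi> i l) z"
    proof (rule chain_map_comp)
      show "z \<in> simplicial_chains (K i) k" using z by (simp add: mem_cycle_group)
      show "simplicial_map (K i) (K j) (\<phi> i j)" using map I le by blast
      show "\<phi> j l (\<phi> i j v) = \<phi> i l v" if "v \<in> \<Union> (K i)" for v
        using \<phi> I le that unfolding simplicial_filtration_def by blast
    qed
    have il: "i \<le> l" using le by (rule order_trans)
    have "f i j x = homology_class (K j) k (chain_map (\<phi> i j) z)"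
      and cyc: "chain_map (\<phi> i j) z \<in> carrier (simplicial_cycle_group (K j) k)"
      using ind[OF I(1,2) le(1)] z xz by (auto simp: induced_on_homology_def)
    then have "f j l (f i j x) = homology_class (K l) k (chain_map (\<phi> i l) z)"
      using ind[OF I(2,3) le(2)] comp by (simp add: induced_on_homology_def)
    also have "\<dots> = f i l x"
      using ind[OF I(1,3) il] z xz by (simp add: induced_on_homology_def)
    finally show ?thesis .
  qed
  then have "group_filtration I (\<lambda>i. simplicial_homology (K i) k) f"
    using hom homology_comm_group[OF K] unfolding group_filtration_def by blast
  with ind show ?thesis by blast
qed

section \<open>Filtrations of cluster covers and their nerves\<close>

lemma nerve_simplicial_complex: "simplicial_complex (nerve A U)"
  unfolding simplicial_complex_def
proof (intro ballI conjI allI impI)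
  fix \<sigma> \<tau> assume "\<sigma> \<in> nerve A U" "\<tau> \<subseteq> \<sigma> \<and> \<tau> \<noteq> {}"
  moreover from this have "(\<Inter>a\<in>\<sigma>. U a) \<subseteq> (\<Inter>a\<in>\<tau>. U a)" by blast
  ultimately show "\<tau> \<in> nerve A U" by (auto simp: nerve_def intro: finite_subset)
qed (auto simp: nerve_def)

lemma nerve_filtration:
  assumes u: "cover_filtration I A U u"
  shows "simplicial_filtration I (\<lambda>i. nerve (A i) (U i)) u"
  unfolding simplicial_filtration_def
proof (intro conjI ballI impI)
  fix i j assume ij: "i \<in> I" "j \<in> I" "i \<le> j"
  then have step: "\<And>a. a \<in> A i \<Longrightarrow> u i j a \<in> A j \<and> U i a \<subseteq> U j (u i j a)"
    using u by (simp add: cover_filtration_def)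
  show "simplicial_map (nerve (A i) (U i)) (nerve (A j) (U j)) (u i j)"
    unfolding simplicial_map_def
  proof
    fix \<sigma> assume "\<sigma> \<in> nerve (A i) (U i)"
    then obtain x where \<sigma>: "\<sigma> \<subseteq> A i" "finite \<sigma>" "\<sigma> \<noteq> {}" and x: "\<And>a. a \<in> \<sigma> \<Longrightarrow> x \<in> U i a"
      by (auto simp: nerve_def)
    have "x \<in> (\<Inter>a\<in>u i j ` \<sigma>. U j a)" using step \<sigma>(1) x by blast
    then show "u i j ` \<sigma> \<in> nerve (A j) (U j)" using step \<sigma> unfolding nerve_def by blast
  qed
next
  fix i j l v assume I: "i \<in> I" "j \<in> I" "l \<in> I" "i \<le> j \<and> j \<le> l"
    and "v \<in> \<Union> (nerve (A i) (U i))"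
  then have "v \<in> A i" by (auto simp: nerve_def)
  with u I show "u j l (u i j v) = u i l v" by (simp add: cover_filtration_def)
qed (rule nerve_simplicial_complex)

text \<open>A cluster is sent to the unique cluster containing it in the bin prescribed by the filtration of
  bins; the composition law holds because that of the bins does and the containing cluster is unique.\<close>

lemma cluster_cover_filtration:
  assumes fin: "\<And>i a. i \<in> I \<Longrightarrow> a \<in> A i \<Longrightarrow> finite (B i a)"
    and b: "cover_filtration I A B b"
    and C: "\<And>i a. i \<in> I \<Longrightarrow> a \<in> A i \<Longrightarrow> dbscan_clusters \<epsilon> m (B i a) (C i a)"
    and nofree: "\<And>i a s. i \<in> I \<Longrightarrow> a \<in> A i \<Longrightarrow> \<not> free_border_point (B i a) \<epsilon> m s"
  shows "\<exists>u. cover_filtration I (\<lambda>i. cluster_index (A i) (C i)) (\<lambda>i. cluster_of (C i)) u"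
proof -
  have bA: "b i j a \<in> A j" and bB: "B i a \<subseteq> B j (b i j a)"
    if "i \<in> I" "j \<in> I" "i \<le> j" "a \<in> A i" for i j a
    using b that by (auto simp: cover_filtration_def)
  have uniq: "\<exists>!n. n < length (C j (b i j a)) \<and> C i a ! r \<subseteq> C j (b i j a) ! n"
    if "i \<in> I" "j \<in> I" "i \<le> j" "a \<in> A i" "r < length (C i a)" for i j a r
    using that bA bB fin C nofree by (intro cluster_in_unique_cluster[of \<epsilon> m "B i a" _ "B j (b i j a)"]) auto
  define n where "n i j a r = (THE n. n < length (C j (b i j a)) \<and> C i a ! r \<subseteq> C j (b i j a) ! n)"
    for i j a r
  have n: "n i j a r < length (C j (b i j a))" "C i a ! r \<subseteq> C j (b i j a) ! n i j a r"
    if "i \<in> I" "j \<in> I" "i \<le> j" "a \<in> A i" "r < length (C i a)" for i j a r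
    using theI'[OF uniq[OF that]] by (auto simp: n_def)
  have "n j l (b i j a) (n i j a r) = n i l a r" and "b j l (b i j a) = b i l a"
    if I: "i \<in> I" "j \<in> I" "l \<in> I" and le: "i \<le> j" "j \<le> l" and a: "a \<in> A i"
      and r: "r < length (C i a)" for i j l a r
  proof -
    have il: "i \<le> l" using le by (rule order_trans)
    show bb: "b j l (b i j a) = b i l a"
      using b I le a unfolding cover_filtration_def by blast
    note nij = n[OF I(1,2) le(1) a r]
    note njl = n[OF I(2,3) le(2) bA[OF I(1,2) le(1) a] nij(1), unfolded bb]
    show "n j l (b i j a) (n i j a r) = n i l a r"
      using uniq[OF I(1,3) il a r] n[OF I(1,3) il a r] njl nij(2) by blast
  qed
  then have "cover_filtration I (\<lambda>i. cluster_index (A i) (C i)) (\<lambda>i. cluster_of (C i))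
      (\<lambda>i j v. (b i j (fst v), n i j (fst v) (snd v)))"
    using n bA unfolding cover_filtration_def cluster_index_def cluster_of_def by auto
  then show ?thesis by blast
qed

theorem theorem6:
  fixes X :: "'a::metric_space set" and k :: int and \<epsilon> :: real and MinPts :: nat
    and I :: "'i::order set"
    and A :: "'i \<Rightarrow> 'b set" and B :: "'i \<Rightarrow> 'b \<Rightarrow> 'a set" and b :: "'i \<Rightarrow> 'i \<Rightarrow> 'b \<Rightarrow> 'b"
    and C :: "'i \<Rightarrow> 'b \<Rightarrow> 'a set list"
  assumes "finite X" and "MinPts > 0"
    and "\<forall>i\<in>I. bin_cover X (A i) (B i)"
    and "cover_filtration I A B b"
    and "\<forall>i\<in>I. \<forall>a\<in>A i. dbscan_clusters \<epsilon> MinPts (B i a) (C i a)"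
    and "\<forall>i\<in>I. \<forall>a\<in>A i. \<not> (\<exists>s. free_border_point (B i a) \<epsilon> MinPts s)"
  shows "\<exists>u \<phi>.
      cover_filtration I (\<lambda>i. cluster_index (A i) (C i)) (\<lambda>i. cluster_of (C i)) u \<and>
      simplicial_filtration I (\<lambda>i. cluster_nerve (A i) (C i)) \<phi> \<and>
      (\<forall>i\<in>I. \<forall>j\<in>I. i \<le> j \<longrightarrow> (\<forall>v\<in>cluster_index (A i) (C i). \<phi> i j v = u i j v)) \<and>
      (\<exists>f :: 'i \<Rightarrow> 'i \<Rightarrow> (('b \<times> nat) list \<Rightarrow> 'g::ab_group_add) set \<Rightarrow> (('b \<times> nat) list \<Rightarrow> 'g) set.
         group_filtration I (\<lambda>i. simplicial_homology (cluster_nerve (A i) (C i)) k) f \<and>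
         (\<forall>i\<in>I. \<forall>j\<in>I. i \<le> j \<longrightarrow>
            induced_on_homology (cluster_nerve (A i) (C i)) (cluster_nerve (A j) (C j)) k
              (\<phi> i j) (f i j)))"
proof -
  have fin: "finite (B i a)" if "i \<in> I" "a \<in> A i" for i a
  proof -
    have "B i a \<subseteq> X" using assms(3) that by (simp add: bin_cover_def)
    then show ?thesis using assms(1) by (rule finite_subset)
  qed
  have C: "dbscan_clusters \<epsilon> MinPts (B i a) (C i a)" if "i \<in> I" "a \<in> A i" for i a
    using assms(5) that by blast
  have nofree: "\<not> free_border_point (B i a) \<epsilon> MinPts s" if "i \<in> I" "a \<in> A i" for i a s
    using assms(6) that by blast
  obtain u where u: "cover_filtration I (\<lambda>i. cluster_index (A i) (C i)) (\<lambda>i. cluster_of (C i)) u"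
    using cluster_cover_filtration[OF fin assms(4) C nofree] by (rule exE)
  then have nerves: "simplicial_filtration I (\<lambda>i. cluster_nerve (A i) (C i)) u"
    unfolding cluster_nerve_def by (rule nerve_filtration)
  show ?thesis
    by (rule exI[of _ u], rule exI[of _ u])
      (intro conjI u nerves simplicial_filtration_homology[OF nerves], simp)
qed

end
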